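(* Let $q\in(0,1)$, $b>0$, let $n$ be a positive integer and $a=bq^n$. Let $f:[a,b]\to\mathbb{R}$ be a convex function. Then $$f\left(\frac{a+b}{[2]_q}\right)\le\frac{1}{b-a}G_q(f;a,b)\le\frac{1}{[2]_q}\left(q\,f\left(\frac{a}{q}\right)+f(b)\right).$$
   Context: For $q\in(0,1)$, $b>0$, a positive integer $n$ and $a=bq^n$, the restricted $q$-integral is $G_q(f;a,b)=b(1-q)\sum_{k=0}^{n-1}f(bq^k)q^k$. Also $[n]_q=\frac{1-q^n}{1-q}$, so $[2]_q=1+q$. *)

theory Defs
  imports "HOL-Analysis.Analysis"
begin

definition q_number :: "real \<Rightarrow> nat \<Rightarrow> real" where
  "q_number q n = (1 - q ^ n) / (1 - q)"

text \<open>
  The restricted q-integral of f over the interval with upper limit b and lower limit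
  a = b * q ^ n. For 0 < q < 1 and b > 0 the number n determines a and conversely, so n is
  taken as the parameter in place of a.
\<close>

definition restricted_q_integral :: "real \<Rightarrow> nat \<Rightarrow> (real \<Rightarrow> real) \<Rightarrow> real \<Rightarrow> real" where
  "restricted_q_integral q n f b = b * (1 - q) * (\<Sum>k<n. f (b * q ^ k) * q ^ k)"

end

theory Submission imports Defs begin

text \<open>
  Divided by \<open>b - a = b (1 - q ^ n)\<close>, the restricted q-integral is the weighted mean of
  \<open>f\<close> at the nodes \<open>b q ^ k\<close>, \<open>k < n\<close>, with weights \<open>(1 - q) q ^ k / (1 - q ^ n)\<close> that sum to 1.
  By the geometric sum with ratio \<open>q\<^sup>2\<close>, the weighted mean of the nodes themselves is
  \<open>(a + b) / (1 + q)\<close>. The lower bound is therefore Jensen's inequality. For the upper bound,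
  all nodes lie in \<open>[a / q, b]\<close>, so \<open>f\<close> is bounded there by its chord over this interval
  (lemma \<open>convex_on_weighted_mean_le_chord\<close>), and the chord takes the value
  \<open>(q f(a / q) + f b) / (1 + q)\<close> at the mean of the nodes, because
  \<open>a + b = q (a / q) + b\<close>. For \<open>n = 1\<close> the only node is \<open>b\<close> and the upper bound is an equality.
\<close>

text \<open>
  The converse of Jensen's inequality: the weighted mean of a convex function is at most the
  value of its chord over \<open>[c, d]\<close> at the weighted mean of the nodes, here multiplied by \<open>d - c\<close>.
\<close>

lemma convex_on_weighted_mean_le_chord:
  fixes f :: "real \<Rightarrow> real" and w x :: "'i \<Rightarrow> real"
  assumes f: "convex_on {c..d} f" and "c < d"
    and w: "\<And>i. i \<in> I \<Longrightarrow> 0 \<le> w i" and sum_w: "(\<Sum>i\<in>I. w i) = 1"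
    and x: "\<And>i. i \<in> I \<Longrightarrow> x i \<in> {c..d}"
  shows "(d - c) * (\<Sum>i\<in>I. w i * f (x i))
           \<le> (d - (\<Sum>i\<in>I. w i * x i)) * f c + ((\<Sum>i\<in>I. w i * x i) - c) * f d"
proof -
  have chord: "(d - c) * f y \<le> (d - y) * f c + (y - c) * f d" if y: "y \<in> {c..d}" for y
  proof -
    have "f y \<le> (f d - f c) / (d - c) * (y - c) + f c"
      using convex_onD_Icc'[OF f y] .
    then have "(d - c) * f y \<le> (d - c) * ((f d - f c) / (d - c) * (y - c) + f c)"
      using \<open>c < d\<close> by (intro mult_left_mono) auto
    also have "\<dots> = (f d - f c) * (y - c) + (d - c) * f c"
      using \<open>c < d\<close> by (simp add: distrib_left)
    finally show ?thesis
      by (simp add: algebra_simps)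
  qed
  have "(d - c) * (\<Sum>i\<in>I. w i * f (x i)) = (\<Sum>i\<in>I. w i * ((d - c) * f (x i)))"
    by (simp add: sum_distrib_left algebra_simps)
  also have "\<dots> \<le> (\<Sum>i\<in>I. w i * ((d - x i) * f c + (x i - c) * f d))"
    using chord w x by (intro sum_mono mult_left_mono) auto
  also have "\<dots> = (\<Sum>i\<in>I. w i * (d * f c - c * f d) + w i * x i * (f d - f c))"
    by (intro sum.cong) (auto simp: algebra_simps)
  also have "\<dots> = (\<Sum>i\<in>I. w i) * (d * f c - c * f d) + (\<Sum>i\<in>I. w i * x i) * (f d - f c)"
    by (simp add: sum.distrib sum_distrib_right)
  also have "\<dots> = (d - (\<Sum>i\<in>I. w i * x i)) * f c + ((\<Sum>i\<in>I. w i * x i) - c) * f d"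
    by (simp add: sum_w algebra_simps)
  finally show ?thesis .
qed

lemma sum_q_weights:
  fixes q :: real
  assumes "0 < q" "q < 1" "n \<ge> 1"
  shows "(\<Sum>k<n. (1 - q) * q ^ k / (1 - q ^ n)) = 1"
proof -
  have "q ^ n < 1"
    using assms by (simp add: power_less_one_iff)
  moreover have "(1 - q) * (\<Sum>k<n. q ^ k) = 1 - q ^ n"
    using one_diff_power_eq[of q n] by simp
  ultimately show ?thesis
    by (simp add: sum_distrib_left flip: sum_divide_distrib)
qed

lemma sum_q_weights_nodes:
  fixes q b :: real
  assumes "0 < q" "q < 1" "n \<ge> 1"
  shows "(\<Sum>k<n. (1 - q) * q ^ k / (1 - q ^ n) * (b * q ^ k)) = (b * q ^ n + b) / (1 + q)"
proof -
  have "q ^ n < 1"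
    using assms by (simp add: power_less_one_iff)
  have "(1 - q\<^sup>2) * (\<Sum>k<n. (q\<^sup>2) ^ k) = 1 - (q\<^sup>2) ^ n"
    using one_diff_power_eq[of "q\<^sup>2" n] by simp
  then have geo: "(1 - q) * (1 + q) * (\<Sum>k<n. q ^ k * q ^ k) = (1 - q ^ n) * (1 + q ^ n)"
    by (simp add: power2_eq_square power_mult_distrib algebra_simps)
  have "(\<Sum>k<n. (1 - q) * q ^ k / (1 - q ^ n) * (b * q ^ k))
          = (1 - q) * b / (1 - q ^ n) * (\<Sum>k<n. q ^ k * q ^ k)"
    by (simp add: sum_distrib_left sum_divide_distrib mult_ac)
  also have "\<dots> = b * ((1 - q) * (1 + q) * (\<Sum>k<n. q ^ k * q ^ k)) / ((1 - q ^ n) * (1 + q))"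
    using assms by simp
  also have "\<dots> = b * (1 + q ^ n) / (1 + q)"
    unfolding geo using \<open>q ^ n < 1\<close> by simp
  also have "\<dots> = (b * q ^ n + b) / (1 + q)"
    by (simp add: distrib_left add.commute)
  finally show ?thesis .
qed

lemma restricted_q_integral_mean_eq_weighted_sum:
  assumes "b > 0"
  shows "1 / (b - b * q ^ n) * restricted_q_integral q n f b
           = (\<Sum>k<n. (1 - q) * q ^ k / (1 - q ^ n) * f (b * q ^ k))"
proof -
  have "1 / (b - b * q ^ n) * restricted_q_integral q n f b
          = (b * (1 - q)) / (b * (1 - q ^ n)) * (\<Sum>k<n. f (b * q ^ k) * q ^ k)"
    by (simp add: restricted_q_integral_def right_diff_distrib)
  also have "\<dots> = (1 - q) / (1 - q ^ n) * (\<Sum>k<n. f (b * q ^ k) * q ^ k)"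
    using assms by simp
  also have "\<dots> = (\<Sum>k<n. (1 - q) * q ^ k / (1 - q ^ n) * f (b * q ^ k))"
    by (simp add: sum_distrib_left sum_divide_distrib mult_ac)
  finally show ?thesis .
qed

theorem theorem5p1:
  fixes q a b :: real and n :: nat and f :: "real \<Rightarrow> real"
  assumes "0 < q" and "q < 1" and "b > 0" and "n \<ge> 1" and "a = b * q ^ n"
    and "convex_on {a..b} f"
  shows "f ((a + b) / q_number q 2) \<le> 1 / (b - a) * restricted_q_integral q n f b
       \<and> 1 / (b - a) * restricted_q_integral q n f b \<le> 1 / q_number q 2 * (q * f (a / q) + f b)"
proof -
  define w where "w k = (1 - q) * q ^ k / (1 - q ^ n)" for k
  have "q ^ n < 1"
    using assms by (simp add: power_less_one_iff)
  then have w: "0 \<le> w k" for k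
    using assms by (simp add: w_def)
  have sum_w: "(\<Sum>k<n. w k) = 1"
    unfolding w_def using assms by (intro sum_q_weights)
  have mean: "(\<Sum>k<n. w k * (b * q ^ k)) = (a + b) / (1 + q)"
    unfolding w_def using assms sum_q_weights_nodes by simp
  have integral: "1 / (b - a) * restricted_q_integral q n f b = (\<Sum>k<n. w k * f (b * q ^ k))"
    unfolding w_def using assms restricted_q_integral_mean_eq_weighted_sum by simp
  have q2: "q_number q 2 = 1 + q"
    using assms by (simp add: q_number_def power2_eq_square field_simps)
  define c where "c = a / q"
  have c: "c = b * q ^ (n - 1)"
    using assms by (simp add: c_def power_diff)
  have "a \<le> c"
    using assms by (simp add: c_def field_simps)
  have nodes: "b * q ^ k \<in> {c..b}" if "k < n" for k
    using assms that by (auto simp: c intro!: power_decreasing power_le_one)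
  have lower: "f ((a + b) / (1 + q)) \<le> (\<Sum>k<n. w k * f (b * q ^ k))"
  proof -
    have "f (\<Sum>k<n. w k *\<^sub>R (b * q ^ k)) \<le> (\<Sum>k<n. w k * f (b * q ^ k))"
      using assms w sum_w nodes \<open>a \<le> c\<close> by (intro convex_on_sum[where C = "{a..b}"]) force+
    then show ?thesis
      by (simp add: mean)
  qed
  have upper: "(\<Sum>k<n. w k * f (b * q ^ k)) \<le> 1 / (1 + q) * (q * f c + f b)"
  proof (cases "n = 1")
    case True
    \<comment> \<open>The interval \<open>[c, b]\<close> degenerates to the single node \<open>b\<close>.\<close>
    then have "c = b" "(\<Sum>k<n. w k * f (b * q ^ k)) = f b"
      using c sum_w by auto
    moreover have "1 / (1 + q) * (q * f b + f b) = f b"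
      using assms by (simp add: field_simps)
    ultimately show ?thesis
      by simp
  next
    case False
    then have "c < b"
      using assms by (simp add: c power_less_one_iff)
    have "convex_on {c..b} f"
      using assms \<open>a \<le> c\<close> by (auto intro: convex_on_subset)
    then have "(b - c) * (\<Sum>k<n. w k * f (b * q ^ k))
        \<le> (b - (a + b) / (1 + q)) * f c + ((a + b) / (1 + q) - c) * f b"
      using convex_on_weighted_mean_le_chord[of c b f "{..<n}" w "\<lambda>k. b * q ^ k"]
        \<open>c < b\<close> w sum_w nodes by (simp add: mean)
    also have "\<dots> = (b - c) * (1 / (1 + q) * (q * f c + f b))"
    proof -
      have "a = q * c"
        using assms by (simp add: c_def)
      then have "b - (a + b) / (1 + q) = (b - c) * (q / (1 + q))"
        and "(a + b) / (1 + q) - c = (b - c) * (1 / (1 + q))"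
        using assms by (simp_all add: field_simps)
      then show ?thesis
        by (simp only:) (simp add: add_divide_distrib algebra_simps)
    qed
    finally show ?thesis
      using \<open>c < b\<close> by (simp only: mult_le_cancel_left_pos diff_gt_0_iff_gt)
  qed
  show ?thesis
    using lower upper unfolding integral q2 c_def by simp
qed

end
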